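(* Let $B=\{201\}$, and let $A(x,v)$ and $B(x,v,u)$ be the generating functions defined in the context. The generating function $\sum_{n\geq 0}|I_n(201)|\,x^{n+1}$ is equal to $A(x,0)$, and it satisfies $$A(x,0)=\frac{x}{1-2x}+2x^2\,B(x,2x,1).$$
   Context: For $n\ge 0$, $I_n$ denotes the set of inversion sequences $e=e_0e_1\cdots e_n$, i.e. integer sequences with $0\le e_i\le i$ for each $0\le i\le n$. An inversion sequence contains a pattern $\tau$ if it has a (not necessarily consecutive) subsequence order isomorphic to $\tau$ (including equalities); otherwise it avoids $\tau$. $I_n(\tau)$ is the set of $e\in I_n$ avoiding $\tau$, and $I_n(B)$ the set of those avoiding all patterns in $B$. $\mathcal T(B)$ is the rooted plane tree with root $0$ whose level-$n$ nodes are the elements of $I_n(B)$ (root at level 0), where the parent of $e_0\cdots e_n$ is $e_0\cdots e_{n-1}$ and siblings are ordered left to right by increasing last letter. For a node $e$, $\mathcal T(B;e)$ is the subtree consisting of $e$ and its descendants. The generating function for the number of nodes in $\mathcal T(B;e)$ is the power series in which a node at distance $\ell\ge 0$ below the root $e$ contributes $x^{\ell+1}$. Here $0^m$ is the word of $m$ zeros and $0^mj$ is $0^m$ followed by the letter $j$. Let $A_m(x)$ (for $m\ge1$) and $B_{m,j}(x)$ (for $2\le j\le m$) be the generating functions for the number of nodes in $\mathcal T(B;0^m)$ and $\mathcal T(B;0^mj)$ respectively, and set $$A(x,v)=\sum_{m\ge1}A_m(x)v^{m-1},\qquad B(x,v,u)=\sum_{m\ge2}\sum_{j=2}^m B_{m,j}(x)\,v^{m-2}u^{m-j}.$$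 *)

theory Defs
  imports
    "HOL-Library.Sublist"
    "HOL-Computational_Algebra.Computational_Algebra"
begin

definition order_isomorphic :: "nat list \<Rightarrow> nat list \<Rightarrow> bool" where
  "order_isomorphic s t \<longleftrightarrow> length s = length t \<and>
     (\<forall>i<length s. \<forall>j<length s.
        (s ! i < s ! j \<longleftrightarrow> t ! i < t ! j) \<and> (s ! i = s ! j \<longleftrightarrow> t ! i = t ! j))"

definition contains_pattern :: "nat list \<Rightarrow> nat list \<Rightarrow> bool" where
  "contains_pattern e t \<longleftrightarrow> (\<exists>s. subseq s e \<and> order_isomorphic s t)"

definition inversion_sequences :: "nat \<Rightarrow> nat list set" where
  "inversion_sequences n = {e. length e = n + 1 \<and> (\<forall>i\<le>n. e ! i \<le> i)}"

definition avoiding_inversion_sequences :: "nat list set \<Rightarrow> nat \<Rightarrow> nat list set" where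
  "avoiding_inversion_sequences P n =
     {e \<in> inversion_sequences n. \<forall>t\<in>P. \<not> contains_pattern e t}"

definition tree_nodes :: "nat list set \<Rightarrow> nat list set" where
  "tree_nodes P = (\<Union>n. avoiding_inversion_sequences P n)"

text \<open>
  Pairs (parent, child) of the generating tree of \<open>P\<close>. The left-to-right order of siblings
  is not recorded: it plays no role in counting nodes.
\<close>
definition tree_edges :: "nat list set \<Rightarrow> (nat list \<times> nat list) set" where
  "tree_edges P = {(e, f). e \<in> tree_nodes P \<and> f \<in> tree_nodes P \<and> e = butlast f}"

text \<open>The nodes of the subtree rooted at \<open>e\<close> at distance \<open>l\<close> below \<open>e\<close>.\<close>
definition subtree_level :: "nat list set \<Rightarrow> nat list \<Rightarrow> nat \<Rightarrow> nat list set" where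
  "subtree_level P e l = {f \<in> tree_nodes P. (e, f) \<in> tree_edges P ^^ l}"

text \<open>The factor \<open>fps_X\<close> makes a node at distance \<open>l\<close> contribute \<open>x ^ (l + 1)\<close>.\<close>
definition subtree_gf :: "nat list set \<Rightarrow> nat list \<Rightarrow> rat fps" where
  "subtree_gf P e = fps_X * Abs_fps (\<lambda>l. of_nat (card (subtree_level P e l)))"

definition A_coeff :: "nat list set \<Rightarrow> nat \<Rightarrow> rat fps" where
  "A_coeff P m = subtree_gf P (replicate m 0)"

definition B_coeff :: "nat list set \<Rightarrow> nat \<Rightarrow> nat \<Rightarrow> rat fps" where
  "B_coeff P m j = subtree_gf P (replicate m 0 @ [j])"

text \<open>
  The series \<open>A(x,v)\<close>, as a power series in \<open>v\<close> over the power series in \<open>x\<close>; the coefficient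
  of \<open>v ^ k\<close> belongs to \<open>m = k + 1\<close>.
\<close>
definition A_gf :: "nat list set \<Rightarrow> rat fps fps" where
  "A_gf P = Abs_fps (\<lambda>k. A_coeff P (k + 1))"

text \<open>
  The series \<open>B(x,v,u)\<close>, as a power series in \<open>v\<close>; the coefficient of \<open>v ^ k\<close> belongs to
  \<open>m = k + 2\<close> and is a polynomial in \<open>u\<close> over the power series in \<open>x\<close>, so that \<open>u\<close> may be
  specialised to any power series in \<open>x\<close>, in particular to \<open>1\<close>.
\<close>
definition B_gf :: "nat list set \<Rightarrow> rat fps poly fps" where
  "B_gf P = Abs_fps (\<lambda>k. \<Sum>j = 2..k + 2. monom (B_coeff P (k + 2) j) (k + 2 - j))"

text \<open>
  Substitution of a power series \<open>g\<close> in \<open>x\<close> for the outer variable \<open>v\<close>; the infinite sum is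
  taken in the \<open>x\<close>-adic topology and converges whenever \<open>g\<close> has no constant term.
\<close>
definition subst_v :: "'a::comm_ring_1 fps fps \<Rightarrow> 'a fps \<Rightarrow> 'a fps" where
  "subst_v F g = (\<Sum>n. fps_nth F n * g ^ n)"

lemma subst_v_sums:
  fixes F :: "'a::comm_ring_1 fps fps"
  assumes "fps_nth g 0 = 0"
  shows "(\<lambda>n. fps_nth F n * g ^ n) sums subst_v F g"
proof -
  have zero: "fps_nth (fps_nth F n * g ^ n) k = 0" if "k < n" for n k
  proof -
    have "fps_nth (g ^ n) i = 0" if "i < n" for i
      using startsby_zero_power_prefix[OF assms, of n] that by auto
    then show ?thesis using that by (auto simp: fps_mult_nth intro!: sum.neutral)
  qed
  define L where "L = Abs_fps (\<lambda>k. \<Sum>n\<le>k. fps_nth (fps_nth F n * g ^ n) k)"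
  have "(\<lambda>n. fps_nth F n * g ^ n) sums L"
    unfolding sums_def
  proof (rule tendsto_fpsI)
    fix k
    have "fps_nth (\<Sum>i<n. fps_nth F i * g ^ i) k = fps_nth L k" if "n > k" for n
      unfolding L_def fps_sum_nth fps_nth_Abs_fps
      by (rule sum.mono_neutral_right) (use that zero in auto)
    then show "\<forall>\<^sub>F n in sequentially.
        fps_nth (\<Sum>i<n. fps_nth F i * g ^ i) k = fps_nth L k"
      unfolding eventually_sequentially by (intro exI[of _ "Suc k"]) auto
  qed
  then show ?thesis
    unfolding subst_v_def by (rule summable_sums[OF sums_summable])
qed

definition A_at :: "nat list set \<Rightarrow> rat fps \<Rightarrow> rat fps" where
  "A_at P v = subst_v (A_gf P) v"

definition B_at :: "nat list set \<Rightarrow> rat fps \<Rightarrow> rat fps \<Rightarrow> rat fps" where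
  "B_at P v u = subst_v (Abs_fps (\<lambda>k. poly (fps_nth (B_gf P) k) u)) v"

end

theory Submission
  imports Defs
begin

text \<open>
  The level-\<open>l\<close> descendants of a node \<open>e\<close> are the nodes \<open>e @ w\<close> with \<open>length w = l\<close>, because every
  nonempty prefix of a node is a node. Hence the series of the subtree at \<open>e\<close> is \<open>x\<close> times one plus
  the sum of the series of the subtrees at \<open>e @ [j]\<close>, for \<open>j \<le> length e\<close>
  (\<open>subtree_gf_children\<close>).

  For the pattern \<open>201\<close>, a letter at most \<open>1\<close> that is put in front of a word never takes part in
  an occurrence: it would have to play the role of \<open>2\<close>, which exceeds two distinct letters. So leading
  letters \<open>0\<close> and \<open>1\<close> are irrelevant, and \<open>0\<^sup>m 1\<close> and \<open>0\<^sup>m\<^sup>+\<^sup>1\<close> have subtrees of the same shape. The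
  children of \<open>0\<^sup>m\<close> therefore give
  \<open>A\<^sub>m = x + 2 x A\<^sub>m\<^sub>+\<^sub>1 + x (B\<^sub>m\<^sub>,\<^sub>2 + \<dots> + B\<^sub>m\<^sub>,\<^sub>m)\<close> (\<open>A_coeff_recurrence\<close>).
  Iterating this recurrence, with \<open>(2 x)\<^sup>N \<longlonglongrightarrow> 0\<close> in the \<open>x\<close>-adic topology
  (\<open>subst_v_eqI\<close>), expresses \<open>A\<^sub>1\<close> by a geometric series and \<open>B(x, 2 x, 1)\<close>.
  Finally \<open>A\<^sub>1\<close> counts all nodes, since the tree is the subtree at its root \<open>0\<close>.
\<close>

section \<open>Limits of formal power series\<close>

lemma tendsto_add_fps:
  fixes f g :: "'b \<Rightarrow> 'a::group_add fps"
  assumes "(f \<longlongrightarrow> a) F" "(g \<longlongrightarrow> b) F"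
  shows "((\<lambda>x. f x + g x) \<longlongrightarrow> a + b) F"
  unfolding tendsto_fps_iff
proof
  fix n
  have "\<forall>\<^sub>F x in F. fps_nth (f x) n = fps_nth a n" "\<forall>\<^sub>F x in F. fps_nth (g x) n = fps_nth b n"
    using assms unfolding tendsto_fps_iff by auto
  then show "\<forall>\<^sub>F x in F. fps_nth (f x + g x) n = fps_nth (a + b) n"
    by eventually_elim simp
qed

lemma tendsto_mult_left_fps:
  fixes f :: "'b \<Rightarrow> 'a::ring fps"
  assumes "(f \<longlongrightarrow> a) F"
  shows "((\<lambda>x. c * f x) \<longlongrightarrow> c * a) F"
  unfolding tendsto_fps_iff
proof
  fix n
  have "\<forall>\<^sub>F x in F. \<forall>i\<in>{..n}. fps_nth (f x) i = fps_nth a i"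
    using assms unfolding tendsto_fps_iff by (intro eventually_ball_finite) auto
  then show "\<forall>\<^sub>F x in F. fps_nth (c * f x) n = fps_nth (c * a) n"
    by eventually_elim (simp add: fps_mult_nth)
qed

lemma power_mult_tendsto_zero_fps:
  fixes g :: "'a::comm_ring_1 fps"
  assumes "fps_nth g 0 = 0"
  shows "(\<lambda>N. g ^ N * h N) \<longlonglongrightarrow> 0"
proof (rule tendsto_fpsI)
  fix n
  have "fps_nth (g ^ N * h N) n = 0" if "n < N" for N
    using that startsby_zero_power_prefix[OF assms, of N]
    by (auto simp: fps_mult_nth intro!: sum.neutral)
  then show "\<forall>\<^sub>F N in sequentially. fps_nth (g ^ N * h N) n = fps_nth 0 n"
    unfolding eventually_sequentially by (intro exI[of _ "Suc n"]) auto
qed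

text \<open>Iterating \<open>a k = c k + g * a (k + 1)\<close> makes the remainder \<open>g ^ N * a N\<close> vanish in the limit.\<close>
lemma subst_v_eqI:
  fixes g :: "'a::comm_ring_1 fps"
  assumes g: "fps_nth g 0 = 0" and rec: "\<And>k. a k = c k + g * a (Suc k)"
  shows "subst_v (Abs_fps c) g = a 0"
proof -
  have partial: "a 0 = (\<Sum>k<N. c k * g ^ k) + g ^ N * a N" for N
  proof (induction N)
    case (Suc N)
    then show ?case
      using rec[of N] by (simp add: algebra_simps)
  qed simp
  have "(\<lambda>N. \<Sum>k<N. c k * g ^ k) \<longlonglongrightarrow> subst_v (Abs_fps c) g"
    using subst_v_sums[OF g, of "Abs_fps c"] by (simp add: sums_def)
  from tendsto_add_fps[OF this power_mult_tendsto_zero_fps[OF g, of a]]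
  have "(\<lambda>N. a 0) \<longlonglongrightarrow> subst_v (Abs_fps c) g"
    by (simp flip: partial)
  then show ?thesis
    by (simp add: LIMSEQ_const_iff)
qed

lemma subst_v_add:
  fixes g :: "'a::comm_ring_1 fps"
  assumes g: "fps_nth g 0 = 0"
  shows "subst_v (F + G) g = subst_v F g + subst_v G g"
proof -
  have "(\<lambda>n. fps_nth (F + G) n * g ^ n) sums (subst_v F g + subst_v G g)"
    using tendsto_add_fps[OF subst_v_sums[OF g, of F, unfolded sums_def]
        subst_v_sums[OF g, of G, unfolded sums_def]]
    by (simp add: sums_def sum.distrib algebra_simps)
  with subst_v_sums[OF g] show ?thesis
    by (rule sums_unique2)
qed

lemma subst_v_const_mult:
  fixes g :: "'a::comm_ring_1 fps"
  assumes g: "fps_nth g 0 = 0"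
  shows "subst_v (fps_const c * F) g = c * subst_v F g"
proof -
  have "(\<lambda>n. fps_nth (fps_const c * F) n * g ^ n) sums (c * subst_v F g)"
    using tendsto_mult_left_fps[OF subst_v_sums[OF g, of F, unfolded sums_def], of c]
    by (simp add: sums_def sum_distrib_left mult.assoc)
  with subst_v_sums[OF g] show ?thesis
    by (rule sums_unique2)
qed

lemma subst_v_geometric:
  fixes g :: "'a::field fps"
  assumes g: "fps_nth g 0 = 0"
  shows "subst_v (Abs_fps (\<lambda>_. 1)) g = inverse (1 - g)"
proof (rule subst_v_eqI[OF g])
  have "(1 - g) * inverse (1 - g) = 1"
    using g by (intro inverse_mult_eq_1') simp
  then show "inverse (1 - g) = 1 + g * inverse (1 - g)"
    by (simp add: algebra_simps)
qed

lemma subst_v_zero: "subst_v F 0 = fps_nth F 0"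
  using subst_v_eqI[of 0 "fps_nth F" "fps_nth F"] by (simp add: fps_nth_inverse)

section \<open>Subtrees of the generating tree\<close>

lemma tree_nodes_iff:
  "e \<in> tree_nodes P \<longleftrightarrow>
     e \<noteq> [] \<and> (\<forall>i<length e. e ! i \<le> i) \<and> (\<forall>t\<in>P. \<not> contains_pattern e t)"
proof -
  have "(\<exists>n. length e = n + 1 \<and> (\<forall>i\<le>n. e ! i \<le> i)) \<longleftrightarrow> e \<noteq> [] \<and> (\<forall>i<length e. e ! i \<le> i)"
    by (cases e) (auto simp: less_Suc_eq_le)
  then show ?thesis
    by (auto simp: tree_nodes_def avoiding_inversion_sequences_def inversion_sequences_def)
qed

lemma tree_nodes_prefix:
  assumes "e @ w \<in> tree_nodes P" "e \<noteq> []"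
  shows "e \<in> tree_nodes P"
proof -
  have "contains_pattern (e @ w) t" if "contains_pattern e t" for t
    using that unfolding contains_pattern_def by (meson list_emb_append2 subseq_order.trans subseq_rev_drop_many)
  moreover have "e ! i \<le> i" if "i < length e" for i
    using assms(1) that by (auto simp: tree_nodes_iff nth_append dest: spec[of _ i])
  ultimately show ?thesis
    using assms by (auto simp: tree_nodes_iff)
qed

lemma subtree_level_eq:
  assumes "e \<noteq> []"
  shows "subtree_level P e l = {f \<in> tree_nodes P. \<exists>w. length w = l \<and> f = e @ w}"
proof -
  have "(e, f) \<in> tree_edges P ^^ l \<longleftrightarrow> (\<exists>w. length w = l \<and> f = e @ w)"
    if "f \<in> tree_nodes P" for f
    using that
  proof (induction l arbitrary: f)
    case 0
    then show ?case by auto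
  next
    case (Suc l)
    show ?case
    proof
      assume "(e, f) \<in> tree_edges P ^^ Suc l"
      then obtain h where h: "(e, h) \<in> tree_edges P ^^ l" "(h, f) \<in> tree_edges P"
        by auto
      then have "h \<in> tree_nodes P" "h = butlast f"
        by (auto simp: tree_edges_def)
      moreover from this h Suc.IH obtain w where "length w = l" "h = e @ w"
        by blast
      moreover have "f \<noteq> []"
        using Suc.prems by (simp add: tree_nodes_iff)
      ultimately have "length (w @ [last f]) = Suc l" "f = e @ w @ [last f]"
        by (simp_all add: append_butlast_last_id flip: append_assoc)
      then show "\<exists>w. length w = Suc l \<and> f = e @ w" by blast
    next
      assume "\<exists>w. length w = Suc l \<and> f = e @ w"
      then obtain w y where w: "length w = l" "f = (e @ w) @ [y]"
        by (auto simp: length_Suc_conv_rev)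
      with Suc.prems assms have node: "e @ w \<in> tree_nodes P"
        by (metis append_is_Nil_conv tree_nodes_prefix)
      with w Suc.IH have "(e, e @ w) \<in> tree_edges P ^^ l" by blast
      moreover have "(e @ w, f) \<in> tree_edges P"
        using node Suc.prems w by (simp add: tree_edges_def butlast_append)
      ultimately show "(e, f) \<in> tree_edges P ^^ Suc l" by auto
    qed
  qed
  then show ?thesis
    by (auto simp: subtree_level_def)
qed

lemma finite_subtree_level:
  assumes "e \<noteq> []"
  shows "finite (subtree_level P e l)"
proof (rule finite_subset)
  show "subtree_level P e l \<subseteq> {f. set f \<subseteq> {..length e + l} \<and> length f = length e + l}"
  proof safe
    fix f assume f: "f \<in> subtree_level P e l"
    then show "length f = length e + l"
      using assms by (auto simp: subtree_level_eq)
    fix y assume "y \<in> set f"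
    then obtain i where "i < length f" "y = f ! i"
      by (auto simp: in_set_conv_nth)
    with f \<open>length f = length e + l\<close> show "y \<le> length e + l"
      by (auto simp: subtree_level_def tree_nodes_iff dest: spec[of _ i])
  qed
qed (simp add: finite_lists_length_eq)

lemma subtree_level_Suc:
  assumes "e \<noteq> []"
  shows "subtree_level P e (Suc l) = (\<Union>j\<le>length e. subtree_level P (e @ [j]) l)"
proof (intro equalityI subsetI)
  fix f assume "f \<in> subtree_level P e (Suc l)"
  then obtain j w where f: "f \<in> tree_nodes P" "length w = l" "f = e @ j # w"
    using assms by (auto simp: subtree_level_eq length_Suc_conv)
  then have "(e @ j # w) ! length e \<le> length e"
    unfolding tree_nodes_iff by (metis add_Suc_right length_Cons length_append less_add_Suc1)
  with f show "f \<in> (\<Union>j\<le>length e. subtree_level P (e @ [j]) l)"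
    by (auto simp: subtree_level_eq)
next
  fix f assume "f \<in> (\<Union>j\<le>length e. subtree_level P (e @ [j]) l)"
  then obtain j w where "f \<in> tree_nodes P" "length w = l" "f = e @ j # w"
    by (auto simp: subtree_level_eq)
  then have "f \<in> tree_nodes P \<and> length (j # w) = Suc l \<and> f = e @ j # w" by simp
  then show "f \<in> subtree_level P e (Suc l)"
    unfolding subtree_level_eq[OF assms] by blast
qed

lemma card_subtree_level_Suc:
  assumes "e \<noteq> []"
  shows "card (subtree_level P e (Suc l)) = (\<Sum>j\<le>length e. card (subtree_level P (e @ [j]) l))"
  unfolding subtree_level_Suc[OF assms]
  by (rule card_UN_disjoint) (simp_all add: finite_subtree_level, auto simp: subtree_level_eq)

text \<open>
  Letters \<open>j\<close> for which \<open>e @ [j]\<close> is not a node contribute the zero series, so the sum may run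
  over all \<open>j \<le> length e\<close>.
\<close>
lemma subtree_gf_children:
  assumes "e \<in> tree_nodes P"
  shows "subtree_gf P e = fps_X * (1 + (\<Sum>j\<le>length e. subtree_gf P (e @ [j])))"
proof -
  have e: "e \<noteq> []" using assms by (simp add: tree_nodes_iff)
  have "Abs_fps (\<lambda>l. of_nat (card (subtree_level P e l))) =
      (1 + (\<Sum>j\<le>length e. subtree_gf P (e @ [j])))"
  proof (rule fps_ext)
    fix l
    have "subtree_level P e 0 = {e}"
      using assms e by (auto simp: subtree_level_eq)
    then show "fps_nth (Abs_fps (\<lambda>l. of_nat (card (subtree_level P e l)))) l =
        fps_nth (1 + (\<Sum>j\<le>length e. subtree_gf P (e @ [j]))) l"
      by (cases l) (auto simp: subtree_gf_def fps_sum_nth card_subtree_level_Suc[OF e])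
  qed
  then show ?thesis
    by (simp add: subtree_gf_def)
qed

text \<open>The letter \<open>e\<^sub>0\<close> of an inversion sequence is \<open>0\<close>, so every node descends from the root.\<close>
lemma avoiding_eq_subtree_level_root:
  "avoiding_inversion_sequences P n = subtree_level P [0] n"
proof -
  have "e \<in> avoiding_inversion_sequences P n \<longleftrightarrow>
      e \<in> tree_nodes P \<and> (\<exists>w. length w = n \<and> e = [0] @ w)" for e
  proof (cases e)
    case (Cons x w)
    then show ?thesis
      by (auto simp: tree_nodes_iff avoiding_inversion_sequences_def inversion_sequences_def
          less_Suc_eq_le)
  qed (simp add: avoiding_inversion_sequences_def inversion_sequences_def)
  then show ?thesis
    by (auto simp: subtree_level_eq)
qed

section \<open>Words avoiding 201\<close>

lemma contains_201_iff:
  "contains_pattern e [2, 0, 1] \<longleftrightarrow> (\<exists>a b c. a < b \<and> b < c \<and> subseq [c, a, b] e)"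
proof -
  have iso: "order_isomorphic s [2, 0, 1] \<longleftrightarrow> (\<exists>a b c. a < b \<and> b < c \<and> s = [c, a, b])" for s
  proof
    assume s: "order_isomorphic s [2, 0, 1]"
    then have "length s = 3" by (simp add: order_isomorphic_def)
    then obtain c a b where "s = [c, a, b]"
      by (auto simp: numeral_3_eq_3 length_Suc_conv)
    moreover have "s ! i < s ! j \<longleftrightarrow> [2, 0, 1::nat] ! i < [2, 0, 1] ! j"
      if "i < length s" "j < length s" for i j
      using s that unfolding order_isomorphic_def by blast
    from this[of 1 2] this[of 2 0] \<open>length s = 3\<close> have "s ! 1 < s ! 2" "s ! 2 < s ! 0"
      by simp_all
    ultimately show "\<exists>a b c. a < b \<and> b < c \<and> s = [c, a, b]"
      by simp
  qed (auto simp: order_isomorphic_def less_Suc_eq)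
  show ?thesis
    unfolding contains_pattern_def iso by blast
qed

lemma contains_201_Cons_small:
  assumes "x \<le> 1"
  shows "contains_pattern (x # e) [2, 0, 1] \<longleftrightarrow> contains_pattern e [2, 0, 1]"
proof -
  have "subseq [c, a, b] (x # e) \<longleftrightarrow> subseq [c, a, b] e" if "a < b" "b < c" for a b c
    using that assms by (simp add: subseq_Cons2_neq)
  then show ?thesis
    unfolding contains_201_iff by blast
qed

lemma contains_201_append_small:
  assumes "\<forall>x\<in>set u. x \<le> 1"
  shows "contains_pattern (u @ w) [2, 0, 1] \<longleftrightarrow> contains_pattern w [2, 0, 1]"
  using assms by (induction u) (simp_all add: contains_201_Cons_small del: One_nat_def)

text \<open>
  Only the length of a prefix with letters at most \<open>1\<close> matters: both the inversion-sequence bounds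
  and the avoidance condition on the remaining letters are independent of its letters.
\<close>
lemma subtree_gf_201_small_prefix:
  assumes "u \<in> tree_nodes {[2, 0, 1]}" "u' \<in> tree_nodes {[2, 0, 1]}" "length u = length u'"
    and small: "\<forall>x\<in>set u. x \<le> 1" "\<forall>x\<in>set u'. x \<le> 1"
  shows "subtree_gf {[2, 0, 1]} u = subtree_gf {[2, 0, 1]} u'"
proof -
  have ne: "u \<noteq> []" "u' \<noteq> []"
    using assms by (auto simp: tree_nodes_iff)
  have swap: "u @ w \<in> tree_nodes {[2, 0, 1]} \<longleftrightarrow> u' @ w \<in> tree_nodes {[2, 0, 1]}" for w
  proof -
    have bounds: "(\<forall>i<length (v @ w). (v @ w) ! i \<le> i) \<longleftrightarrow>
        (\<forall>i<length w. w ! i \<le> length v + i)" if "v \<in> tree_nodes {[2, 0, 1]}" for v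
    proof
      assume *: "\<forall>i<length (v @ w). (v @ w) ! i \<le> i"
      show "\<forall>i<length w. w ! i \<le> length v + i"
      proof (intro allI impI)
        fix i assume "i < length w"
        with *[rule_format, of "length v + i"] show "w ! i \<le> length v + i"
          by simp
      qed
    next
      assume *: "\<forall>i<length w. w ! i \<le> length v + i"
      show "\<forall>i<length (v @ w). (v @ w) ! i \<le> i"
      proof (intro allI impI)
        fix i assume "i < length (v @ w)"
        with that *[rule_format, of "i - length v"] show "(v @ w) ! i \<le> i"
          by (cases "i < length v") (simp_all add: tree_nodes_iff nth_append)
      qed
    qed
    show ?thesis
      unfolding tree_nodes_iff[of "_ @ _"] bounds[OF assms(1)] bounds[OF assms(2)]
      using assms ne by (simp add: contains_201_append_small del: One_nat_def)
  qed
  have level: "subtree_level {[2, 0, 1]} v l =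
      (\<lambda>w. v @ w) ` {w. length w = l \<and> v @ w \<in> tree_nodes {[2, 0, 1]}}"
    if "v \<noteq> []" for v l
    using that by (auto simp: subtree_level_eq)
  have "card (subtree_level {[2, 0, 1]} u l) = card (subtree_level {[2, 0, 1]} u' l)" for l
    unfolding level[OF ne(1)] level[OF ne(2)] by (simp add: card_image inj_on_def swap del: One_nat_def)
  then show ?thesis
    by (simp add: subtree_gf_def)
qed

lemma small_letters_tree_node_201:
  assumes "e \<noteq> []" "\<forall>i<length e. e ! i \<le> min 1 i"
  shows "e \<in> tree_nodes {[2, 0, 1]}"
proof -
  have "\<forall>x\<in>set e. x \<le> 1"
    using assms(2) by (auto simp: in_set_conv_nth)
  then have "\<not> contains_pattern e [2, 0, 1]"
    using contains_201_append_small[of e "[]"] by (simp add: contains_201_iff del: One_nat_def)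
  then show ?thesis
    using assms by (auto simp: tree_nodes_iff)
qed

lemma A_coeff_recurrence:
  assumes "m \<ge> 1"
  shows "A_coeff {[2, 0, 1]} m =
    fps_X * (1 + (\<Sum>j = 2..m. B_coeff {[2, 0, 1]} m j)) + 2 * fps_X * A_coeff {[2, 0, 1]} (m + 1)"
proof -
  let ?P = "{[2, 0, 1]} :: nat list set"
  let ?child = "\<lambda>j. subtree_gf ?P (replicate m 0 @ [j])"
  have zeros: "replicate k 0 \<in> tree_nodes ?P" if "k \<ge> 1" for k
    using that by (intro small_letters_tree_node_201) auto
  have snoc_one: "replicate m 0 @ [1] \<in> tree_nodes ?P"
    using assms by (intro small_letters_tree_node_201) (auto simp: nth_append)
  have child0: "?child 0 = A_coeff ?P (m + 1)"
    by (simp add: A_coeff_def replicate_append_same)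
  have child1: "?child 1 = A_coeff ?P (m + 1)"
    unfolding A_coeff_def
    by (rule subtree_gf_201_small_prefix) (use snoc_one zeros[of "m + 1"] in auto)
  have "{..m} = {0, 1} \<union> {2..m}"
    using assms by auto
  then have "(\<Sum>j\<le>m. ?child j) = ?child 0 + ?child 1 + (\<Sum>j = 2..m. ?child j)"
    by (simp add: sum.union_disjoint)
  then show ?thesis
    using subtree_gf_children[OF zeros[OF assms]]
    unfolding child0 child1 by (simp add: A_coeff_def B_coeff_def algebra_simps)
qed

section \<open>The series at the root\<close>

theorem theorem3p4:
  shows "fps_X * Abs_fps (\<lambda>n. of_nat (card (avoiding_inversion_sequences {[2, 0, 1]} n)))
           = A_at {[2, 0, 1]} 0 \<and>
         A_at {[2, 0, 1]} 0
           = fps_X / (1 - 2 * fps_X) + 2 * fps_X ^ 2 * B_at {[2, 0, 1]} (2 * fps_X) 1"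
proof
  let ?P = "{[2, 0, 1]} :: nat list set"
  let ?g = "2 * fps_X :: rat fps"
  let ?I = "inverse (1 - ?g)"
  let ?S = "\<lambda>k. \<Sum>j = 2..k + 2. B_coeff ?P (k + 2) j"
  have A: "A_at ?P 0 = A_coeff ?P 1"
    by (simp add: A_at_def A_gf_def subst_v_zero)
  show "fps_X * Abs_fps (\<lambda>n. of_nat (card (avoiding_inversion_sequences ?P n))) = A_at ?P 0"
    unfolding A by (simp add: A_coeff_def subtree_gf_def avoiding_eq_subtree_level_root)

  have g: "fps_nth ?g 0 = 0" by simp
  have B: "B_at ?P ?g 1 = subst_v (Abs_fps ?S) ?g"
    by (simp add: B_at_def B_gf_def poly_sum poly_monom
        del: One_nat_def add_2_eq_Suc' sum.cl_ivl_Suc)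
  \<comment> \<open>The iteration starts at \<open>A\<^sub>2\<close>, since \<open>A\<^sub>1\<close> involves no \<open>B\<^sub>m\<^sub>,\<^sub>j\<close>.\<close>
  have shift: "Suc k + 2 = (k + 2) + 1" for k by simp
  have "A_coeff ?P (k + 2) = fps_X * (1 + ?S k) + ?g * A_coeff ?P (Suc k + 2)" for k
    unfolding shift by (rule A_coeff_recurrence) simp
  from subst_v_eqI[OF g, of "\<lambda>k. A_coeff ?P (k + 2)", OF this]
  have "A_coeff ?P 2 = subst_v (Abs_fps (\<lambda>k. fps_X * (1 + ?S k))) ?g"
    by (simp only: add_0)
  also have "Abs_fps (\<lambda>k. fps_X * (1 + ?S k)) =
      fps_const fps_X * (Abs_fps (\<lambda>_. 1) + Abs_fps ?S)"
    by (rule fps_ext) simp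
  also have "subst_v \<dots> ?g = fps_X * (?I + B_at ?P ?g 1)"
    unfolding B subst_v_const_mult[OF g] subst_v_add[OF g] subst_v_geometric[OF g] ..
  finally have A2: "A_coeff ?P 2 = fps_X * (?I + B_at ?P ?g 1)" .
  have "A_coeff ?P 1 = fps_X + ?g * A_coeff ?P 2"
    using A_coeff_recurrence[of 1] by (simp del: One_nat_def)
  also have "\<dots> = fps_X * (1 + ?g * ?I) + 2 * fps_X ^ 2 * B_at ?P ?g 1"
    unfolding A2 by (simp add: algebra_simps power2_eq_square)
  also have "1 + ?g * ?I = ?I"
    using inverse_mult_eq_1'[of "1 - ?g"] by (simp add: algebra_simps)
  also have "fps_X * ?I = fps_X / (1 - ?g)"
    by (simp add: fps_divide_unit)
  finally show "A_at ?P 0 = fps_X / (1 - 2 * fps_X) + 2 * fps_X ^ 2 * B_at ?P (2 * fps_X) 1"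
    unfolding A .
qed

end
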